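(* Let $H$ be a complex Hilbert space, let $d\geqslant 2$ be an integer, and let $T_1,\ldots,T_d$ be bounded self-adjoint linear operators on $H$. Then the joint numerical range $\mathcal W(T_1,\ldots,T_d)\subseteq\mathbb R^d$ has Carathéodory number $\mathfrak c\left(\mathcal W(T_1,\ldots,T_d)\right)\leqslant d-1$. If moreover $d\geqslant 3$ and $\dim(H)\geqslant 3$, then even $\mathfrak c\left(\mathcal W(T_1,\ldots,T_d)\right)\leqslant d-2$.
   Context: For bounded self-adjoint linear operators $T_1,\ldots,T_d$ on a Hilbert space $H$, the joint numerical range is $$\mathcal W(T_1,\ldots,T_d)=\left\{(\langle T_1h,h\rangle,\ldots,\langle T_dh,h\rangle)\mid h\in H,\ \Vert h\Vert=1\right\}\subseteq\mathbb R^d.$$ For a set $S\subseteq\mathbb R^d$, the Carathéodory number $\mathfrak c(S)$ is the smallest positive integer $n$ such that every element of the convex hull of $S$ is a convex combination of at most $n$ elements of $S$. The Hilbert space $H$ may be finite- or infinite-dimensional, and $\dim(H)$ denotes its dimension over $\mathbb C$. *)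

theory Defs
  imports "HOL-Analysis.Analysis"
begin

(* The inner product is linear in its first argument, so that it matches \<langle>T h, h\<rangle>.
   The norm (and with it the topology) of real_normed_vector is required to be the one
   induced by the inner product. *)
class complex_inner = real_normed_vector +
  fixes scaleC :: "complex \<Rightarrow> 'a \<Rightarrow> 'a" (infixr "*\<^sub>C" 75)
    and cinner :: "'a \<Rightarrow> 'a \<Rightarrow> complex"
  assumes scaleC_add_right: "a *\<^sub>C (x + y) = a *\<^sub>C x + a *\<^sub>C y"
    and scaleC_add_left: "(a + b) *\<^sub>C x = a *\<^sub>C x + b *\<^sub>C x"
    and scaleC_scaleC: "a *\<^sub>C (b *\<^sub>C x) = (a * b) *\<^sub>C x"
    and scaleR_scaleC: "r *\<^sub>R x = complex_of_real r *\<^sub>C x"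
    and cinner_commute: "cinner x y = cnj (cinner y x)"
    and cinner_add_left: "cinner (x + y) z = cinner x z + cinner y z"
    and cinner_scaleC_left: "cinner (a *\<^sub>C x) y = a * cinner x y"
    and cinner_self: "cinner x x = complex_of_real ((norm x)\<^sup>2)"

class complex_hilbert_space = complex_inner + complete_space

lemma scaleC_one: "1 *\<^sub>C x = (x :: 'a::complex_inner)"
  using scaleR_scaleC[of 1 x] by simp

global_interpretation complex_vector: vector_space "scaleC :: complex \<Rightarrow> 'a \<Rightarrow> 'a::complex_inner"
  by standard (simp_all add: scaleC_add_right scaleC_add_left scaleC_scaleC scaleC_one)

(* The library's dim is 0 on spaces without a finite basis, hence the case distinction. *)
definition cdim :: "'a::complex_inner set \<Rightarrow> enat" where
  "cdim V = (if \<exists>B. finite B \<and> V \<subseteq> complex_vector.span B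
             then enat (complex_vector.dim V) else \<infinity>)"

definition bounded_clinear :: "('a::complex_inner \<Rightarrow> 'b::complex_inner) \<Rightarrow> bool" where
  "bounded_clinear T \<longleftrightarrow> bounded_linear T \<and> (\<forall>c x. T (c *\<^sub>C x) = c *\<^sub>C T x)"

definition selfadjoint :: "('a::complex_inner \<Rightarrow> 'a) \<Rightarrow> bool" where
  "selfadjoint T \<longleftrightarrow> (\<forall>x y. cinner (T x) y = cinner x (T y))"

(* Re only turns the complex type into the real one: see cinner_selfadjoint_real. *)
definition joint_numerical_range ::
    "('d::finite \<Rightarrow> 'a::complex_inner \<Rightarrow> 'a) \<Rightarrow> (real ^ 'd) set" where
  "joint_numerical_range T = {(\<chi> i. Re (cinner (T i h) h)) | h. norm h = 1}"

lemma cinner_selfadjoint_real: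
  assumes "selfadjoint T"
  shows "complex_of_real (Re (cinner (T h) h)) = cinner (T h) h"
proof -
  have "cnj (cinner (T h) h) = cinner (T h) h"
    using assms cinner_commute[of h "T h"] unfolding selfadjoint_def by simp
  then show ?thesis
    by (simp add: complex_eq_iff)
qed

definition convex_combination_of_at_most :: "nat \<Rightarrow> 'a::real_vector set \<Rightarrow> 'a \<Rightarrow> bool" where
  "convex_combination_of_at_most n S x \<longleftrightarrow>
     (\<exists>F u. finite F \<and> F \<subseteq> S \<and> card F \<le> n \<and> (\<forall>v\<in>F. 0 \<le> u v) \<and>
            sum u F = 1 \<and> (\<Sum>v\<in>F. u v *\<^sub>R v) = x)"

definition caratheodory_number :: "'a::euclidean_space set \<Rightarrow> nat" where
  "caratheodory_number S =
     (LEAST n. 0 < n \<and> (\<forall>x \<in> convex hull S. convex_combination_of_at_most n S x))"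

(* The minimum is taken over a nonempty set, by Caratheodory's theorem. *)
lemma caratheodory_number_exists:
  fixes S :: "'a::euclidean_space set"
  shows "\<exists>n>0. \<forall>x \<in> convex hull S. convex_combination_of_at_most n S x"
proof (intro exI[of _ "DIM('a) + 1"] conjI ballI)
  fix x assume "x \<in> convex hull S"
  then show "convex_combination_of_at_most (DIM('a) + 1) S x"
    unfolding convex_hull_caratheodory convex_combination_of_at_most_def by auto
qed simp

end

theory Submission
  imports Defs "HOL-Real_Asymp.Real_Asymp"
begin

text \<open>
For a unit vector h the pair ((\<langle>T_i h, h\<rangle>)_i, 1) is the value at h of the "energy"
h \<mapsto> ((\<langle>T_i h, h\<rangle>)_i, \<parallel>h\<parallel>^2), a quadratic map into \<real>^d \<times> \<real>. Absorbing the weights into the vectors, a point p is a convex combination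
of at most n points of the joint numerical range exactly if (p, 1) is a sum of at most n energies. So the
task is to write a given sum of energies with few summands.

Shortening long sums. Replacing the vectors h_j by linear combinations with an orthogonal coefficient
matrix does not change the sum of the energies. The real span of the values B(h_i, h_j) of the polar form
lies in a space of dimension d + 1. With n summands there are n diagonal values, and three distinct
indices provide three off-diagonal ones; if n \<ge> 3 and n + 3 > d + 1, these values are linearly
dependent. The dependence is a real symmetric matrix M, diagonal outside a 3 \<times> 3 block, with
\<Sum> M_ij B(h_i, h_j) = 0. By the spectral theorem the vectors may be rotated so that M becomes diagonal;
subtracting the right multiple of this relation annihilates one summand and keeps the other
coefficients nonnegative (\<open>sum_of_squares_drop\<close>). Repetition leaves at most max(2, d - 2) summands,
which settles everything except for d = 2, and for d = 3 in dimension at least 3. There two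
summands have to be merged into one.

Merging two summands. Subtracting p_i from T_i turns the task into: given A(h_1) + A(h_2) = 0 for
A(h) = (\<langle>T_i h, h\<rangle>)_i, find g \<noteq> 0 with A(g) = 0. If A(h_1) and the real and imaginary parts of
(\<langle>T_i h_1, h_2\<rangle>)_i are linearly dependent, as they are for d = 2, then some combination of h_1 and h_2 will do
(\<open>isotropic_of_dependent\<close>). If they are independent and d = 3, then A restricted to the span of h_1 and
h_2 is, in suitable coordinates, the Hopf map (\<alpha>, \<beta>) \<mapsto> (2 cnj \<alpha> \<beta>, |\<alpha>|^2 - |\<beta>|^2); it has no
nontrivial zero. Here a third vector h_3 outside the span helps: on the vectors \<alpha> h_1 + \<beta> h_2 + h_3 the map A becomes the Hopf map plus lower-order terms, and
such a map always has a zero. The topological reason is that the Hopf map is not null-homotopic; the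
elementary proof given here (\<open>complex_and_real_quadratic_zero\<close>) solves the complex equation for \<beta> along a
ray of values of \<alpha> and applies the intermediate value theorem to the real equation.
\<close>

section \<open>A complex and a real quadratic equation in two complex unknowns\<close>

lemma nonneg_to_top_root:
  fixes F :: "real \<Rightarrow> real"
  assumes "continuous_on UNIV F" "F t\<^sub>0 \<le> 0" "filterlim F at_top at_top"
  obtains t where "t \<ge> t\<^sub>0" "F t = 0"
proof -
  have "eventually (\<lambda>t. F t \<ge> 0 \<and> t \<ge> t\<^sub>0) at_top"
    using assms(3) by (intro eventually_conj eventually_ge_at_top) (simp add: filterlim_at_top)
  then obtain t\<^sub>1 where "F t\<^sub>1 \<ge> 0" "t\<^sub>1 \<ge> t\<^sub>0"
    by (auto simp: eventually_at_top_linorder)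
  then obtain t where "t\<^sub>0 \<le> t" "F t = 0"
    using IVT'[of F t\<^sub>0 0 t\<^sub>1] assms continuous_on_subset[OF assms(1)] by auto
  then show ?thesis using that by blast
qed

lemma quadratic_root:
  fixes k b e t\<^sub>0 :: real
  assumes "k > 0" "k * t\<^sub>0\<^sup>2 + b * t\<^sub>0 + e \<le> 0"
  obtains t where "t \<ge> t\<^sub>0" "k * t\<^sup>2 + b * t + e = 0"
proof (rule nonneg_to_top_root[of "\<lambda>t. k * t\<^sup>2 + b * t + e" t\<^sub>0])
  show "filterlim (\<lambda>t. k * t\<^sup>2 + b * t + e) at_top at_top"
    using assms(1) by real_asymp
qed (use assms(2) in \<open>auto intro!: continuous_intros\<close>)

text \<open>
The left-hand side of the real equation. It is positive for large \<alpha> and bounded \<beta>, and negative for large \<beta> and bounded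
\<alpha>. The lemmas below find, on the solution set of the complex equation, a path that connects the two regimes.
\<close>

definition indef :: "complex \<Rightarrow> complex \<Rightarrow> real \<Rightarrow> complex \<Rightarrow> complex \<Rightarrow> real" where
  "indef m n a \<alpha> \<beta> = (cmod \<alpha>)\<^sup>2 - (cmod \<beta>)\<^sup>2 + 2 * Re (m * \<alpha> + n * \<beta>) + a"

text \<open>
The complex equation is real-linear in \<beta>, so along the ray \<alpha> = t u it has a solution
\<beta> = N t / D t with a real determinant D. Where D vanishes but N does not, \<beta> blows up and the real
function tends to -\<infinity>; far out on the ray \<beta> stays bounded and the term |\<alpha>|^2 = t^2 wins.
\<close>

lemma ray_root:
  fixes N :: "real \<Rightarrow> complex" and D :: "real \<Rightarrow> real"
  assumes "cmod u = 1" "continuous_on UNIV N" "continuous_on UNIV D"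
    and "D t\<^sub>0 = 0" "N t\<^sub>0 \<noteq> 0" "\<And>t. t > t\<^sub>0 \<Longrightarrow> D t > 0"
    and lim: "((\<lambda>t. N t / of_real (D t)) \<longlongrightarrow> A) at_top"
  obtains t where "t > t\<^sub>0" "indef m n a (of_real t * u) (N t / of_real (D t)) = 0"
proof -
  define h where "h = (\<lambda>t. indef m n a (of_real t * u) (N t / of_real (D t)))"
  \<comment> \<open>Clearing denominators makes the function continuous up to the point where D vanishes.\<close>
  define F where "F = (\<lambda>t. (D t)\<^sup>2 * (t\<^sup>2 + 2 * Re (m * u) * t + a) - (cmod (N t))\<^sup>2 + 2 * Re (n * N t) * D t)"
  have Fh: "F t = (D t)\<^sup>2 * h t" if "t > t\<^sub>0" for t
  proof -
    define b where "b = N t / of_real (D t)"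
    have "D t > 0" using that assms by simp
    then have N: "N t = of_real (D t) * b" by (simp add: b_def)
    have "cmod (N t) = D t * cmod b"
      using \<open>D t > 0\<close> by (simp add: N norm_mult)
    moreover have "Re (n * N t) = D t * Re (n * b)"
      unfolding N by (simp add: algebra_simps)
    moreover have "h t = t\<^sup>2 - (cmod b)\<^sup>2 + 2 * (Re (m * u) * t + Re (n * b)) + a"
      using assms(1) unfolding h_def indef_def b_def[symmetric] by (simp add: norm_mult algebra_simps)
    ultimately show ?thesis
      unfolding F_def by (simp only:) (simp add: algebra_simps power2_eq_square)
  qed
  have top: "filterlim (\<lambda>t. t\<^sup>2 + 2 * Re (m * u) * t) at_top at_top"
    by real_asymp
  have "((\<lambda>t. - (cmod (N t / of_real (D t)))\<^sup>2 + 2 * Re (n * (N t / of_real (D t))) + a)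
      \<longlongrightarrow> - (cmod A)\<^sup>2 + 2 * Re (n * A) + a) at_top"
    using lim by (intro tendsto_intros)
  then have "filterlim (\<lambda>t. (- (cmod (N t / of_real (D t)))\<^sup>2 + 2 * Re (n * (N t / of_real (D t))) + a)
      + (t\<^sup>2 + 2 * Re (m * u) * t)) at_top at_top"
    using top by (rule filterlim_tendsto_add_at_top)
  moreover have "(\<lambda>t. (- (cmod (N t / of_real (D t)))\<^sup>2 + 2 * Re (n * (N t / of_real (D t))) + a)
      + (t\<^sup>2 + 2 * Re (m * u) * t)) = h"
    using assms(1) by (simp add: h_def indef_def fun_eq_iff norm_mult algebra_simps)
  ultimately have "filterlim h at_top at_top" by (simp only:)
  then have "eventually (\<lambda>t. h t \<ge> 0 \<and> t > t\<^sub>0) at_top"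
    by (intro eventually_conj eventually_gt_at_top) (simp add: filterlim_at_top)
  then obtain t\<^sub>1 where t\<^sub>1: "h t\<^sub>1 \<ge> 0" "t\<^sub>1 > t\<^sub>0"
    by (auto simp: eventually_at_top_linorder)
  have "F t\<^sub>0 < 0" using assms by (simp add: F_def)
  have "continuous_on UNIV F"
    unfolding F_def using assms by (intro continuous_intros)
  then have "continuous_on {t\<^sub>0..t\<^sub>1} F" by (rule continuous_on_subset) simp
  then obtain t where t: "t\<^sub>0 \<le> t" "F t = 0"
    using IVT'[of F t\<^sub>0 0 t\<^sub>1] \<open>F t\<^sub>0 < 0\<close> t\<^sub>1 Fh[of t\<^sub>1] by auto
  with \<open>F t\<^sub>0 < 0\<close> have "t > t\<^sub>0" by (cases "t = t\<^sub>0") auto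
  moreover from this have "h t = 0" using t Fh[of t] assms(6)[of t] by simp
  ultimately show ?thesis using that unfolding h_def by blast
qed

text \<open>
In the degenerate cases nothing blows up along the ray. Instead the solution set of the complex equation contains
two lines that meet in a point, here \<beta> = -p with \<alpha> real, and \<alpha> = 0 with \<beta> + p real. The real function
tends to \<infinity> on the first and to -\<infinity> on the second, so its sign at the common point decides
which of them contains a zero.
\<close>

lemma indefinite_zero_s0_c0:
  obtains \<alpha> \<beta> where "cnj \<alpha> * \<beta> + p * \<alpha> = 0" "indef m n a \<alpha> \<beta> = 0"
proof (cases "indef m n a 0 (-p) \<le> 0")
  case True
  have e: "indef m n a (of_real t) (-p) = 1 * t\<^sup>2 + 2 * Re m * t + (indef m n a 0 (-p))" for t
    by (simp add: indef_def algebra_simps)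
  have "1 * 0\<^sup>2 + 2 * Re m * 0 + indef m n a 0 (-p) \<le> 0" using True by simp
  then obtain t where "1 * t\<^sup>2 + 2 * Re m * t + (indef m n a 0 (-p)) = 0"
    by (rule quadratic_root[rotated]) auto
  then show ?thesis using that[of "of_real t" "-p"] by (simp only: e) simp
next
  case False
  have e: "indef m n a 0 (of_real t - p) = - (1 * t\<^sup>2 + (-2 * Re p - 2 * Re n) * t + - indef m n a 0 (-p))" for t
  proof -
    have "(cmod (of_real t - p))\<^sup>2 = t\<^sup>2 - 2 * Re p * t + (cmod p)\<^sup>2"
      unfolding cmod_power2 by (simp add: power2_eq_square algebra_simps)
    then show ?thesis by (simp add: indef_def algebra_simps)
  qed
  have "1 * 0\<^sup>2 + (-2 * Re p - 2 * Re n) * 0 + - indef m n a 0 (-p) \<le> 0" using False by simp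
  then obtain t where "1 * t\<^sup>2 + (-2 * Re p - 2 * Re n) * t + - indef m n a 0 (-p) = 0"
    by (rule quadratic_root[rotated]) auto
  then show ?thesis using that[of 0 "of_real t - p"] by (simp only: e) simp
qed

text \<open>
The same argument with other lines: \<beta> = 0 with \<alpha> a real multiple of s, and \<alpha> = s with \<beta> a real
multiple of \<i> s. They meet in \<alpha> = s, \<beta> = 0.
\<close>

lemma indefinite_zero_p0_c0:
  assumes "s \<noteq> 0"
  obtains \<alpha> \<beta> where "cnj \<alpha> * \<beta> + s * cnj \<beta> = 0" "indef m n a \<alpha> \<beta> = 0"
proof (cases "indef m n a s 0 \<le> 0")
  case True
  have e: "indef m n a (of_real t * s) 0 = (cmod s)\<^sup>2 * t\<^sup>2 + 2 * Re (m * s) * t + a" for t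
    by (simp add: indef_def norm_mult power_mult_distrib algebra_simps)
  have "(cmod s)\<^sup>2 * 1\<^sup>2 + 2 * Re (m * s) * 1 + a \<le> 0" using True by (simp add: indef_def)
  then obtain t where "(cmod s)\<^sup>2 * t\<^sup>2 + 2 * Re (m * s) * t + a = 0"
    by (rule quadratic_root[rotated]) (use assms in auto)
  then show ?thesis using that[of "of_real t * s" 0] by (simp only: e) simp
next
  case False
  have e: "indef m n a s (of_real t * (\<i> * s)) = - ((cmod s)\<^sup>2 * t\<^sup>2 + (-2 * Re (n * \<i> * s)) * t + - indef m n a s 0)" for t
    by (simp add: indef_def norm_mult power_mult_distrib algebra_simps)
  have "(cmod s)\<^sup>2 * 0\<^sup>2 + (-2 * Re (n * \<i> * s)) * 0 + - indef m n a s 0 \<le> 0" using False by simp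
  then obtain t where "(cmod s)\<^sup>2 * t\<^sup>2 + (-2 * Re (n * \<i> * s)) * t + - indef m n a s 0 = 0"
    by (rule quadratic_root[rotated]) (use assms in auto)
  then show ?thesis using that[of s "of_real t * (\<i> * s)"] by (simp only: e) (simp add: algebra_simps)
qed

text \<open>
The value of \<beta> determined by a real \<alpha> \<noteq> 0 blows up at \<alpha> = 0, because the numerator there is -c.
\<close>

lemma indefinite_zero_s0:
  assumes "c \<noteq> 0"
  obtains \<alpha> \<beta> where "cnj \<alpha> * \<beta> + p * \<alpha> + c = 0" "indef m n a \<alpha> \<beta> = 0"
proof (rule ray_root[of 1 "\<lambda>t. - (p * of_real t + c)" "\<lambda>t. t" 0 "- p" m n a])
  have "((\<lambda>t::real. 1 / t) \<longlongrightarrow> 0) at_top" by real_asymp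
  then have "((\<lambda>t. - p - c * of_real (1 / t)) \<longlongrightarrow> - p - c * of_real 0) at_top"
    by (intro tendsto_intros)
  moreover have "eventually (\<lambda>t. - p - c * of_real (1 / t) = - (p * of_real t + c) / of_real t) at_top"
    using eventually_gt_at_top[of 0] by eventually_elim (simp add: field_simps)
  ultimately show "((\<lambda>t. - (p * of_real t + c) / of_real t) \<longlongrightarrow> - p) at_top"
    by (simp add: tendsto_cong)
next
  fix t :: real
  assume "t > 0" "indef m n a (of_real t * 1) (- (p * of_real t + c) / of_real t) = 0"
  then show ?thesis
    using that[of "of_real t" "- (p * of_real t + c) / of_real t"] by simp
qed (use assms in \<open>auto intro!: continuous_intros\<close>)

text \<open>
Combining the complex equation with its conjugate eliminates the conjugate of \<beta> and gives
(|\<alpha>|^2 - |s|^2) \<beta> = N. So the determinant vanishes on the circle |\<alpha>| = |s|. On it N is a trigonometric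
polynomial in the direction u of \<alpha>; its coefficients are not all zero, so some direction has N \<noteq> 0 there.
\<close>

lemma indefinite_zero_generic:
  assumes "s \<noteq> 0" "p \<noteq> 0 \<or> c \<noteq> 0"
  obtains \<alpha> \<beta> where "cnj \<alpha> * \<beta> + p * \<alpha> + s * cnj \<beta> + c = 0" "indef m n a \<alpha> \<beta> = 0"
proof -
  define \<sigma> where "\<sigma> = cmod s"
  have "\<sigma> > 0" using assms by (simp add: \<sigma>_def)
  define N where "N = (\<lambda>u t. (- p * u\<^sup>2) * of_real (t\<^sup>2) + (s * cnj p * cnj u - c * u) * of_real t + s * cnj c)"
  have "\<exists>u. cmod u = 1 \<and> N u \<sigma> \<noteq> 0"
  proof (rule ccontr)
    assume "\<not> ?thesis"
    then have *: "N u \<sigma> = 0" if "cmod u = 1" for u using that by blast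
    \<comment> \<open>Discrete Fourier transform over the fourth roots of unity: the frequencies 2, 1, -1 and 0 of N
      are distinct modulo 4.\<close>
    have "N 1 \<sigma> + N (-1) \<sigma> + N \<i> \<sigma> + N (-\<i>) \<sigma> = 4 * (s * cnj c)"
      by (simp add: N_def algebra_simps)
    then have "c = 0" using *[of 1] *[of "-1"] *[of \<i>] *[of "-\<i>"] assms by simp
    have "N 1 \<sigma> + N (-1) \<sigma> - N \<i> \<sigma> - N (-\<i>) \<sigma> = - 4 * p * of_real (\<sigma>\<^sup>2)"
      by (simp add: N_def algebra_simps)
    then have "p = 0" using *[of 1] *[of "-1"] *[of \<i>] *[of "-\<i>"] \<open>\<sigma> > 0\<close> by simp
    with \<open>c = 0\<close> assms show False by simp
  qed
  then obtain u where u: "cmod u = 1" "N u \<sigma> \<noteq> 0" by blast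
  define A where "A = - p * u\<^sup>2"
  define B where "B = s * cnj p * cnj u - c * u"
  define C where "C = s * cnj c"
  have N: "N u t = A * of_real (t\<^sup>2) + B * of_real t + C" for t
    by (simp add: N_def A_def B_def C_def)
  define D where "D = (\<lambda>t. t\<^sup>2 - \<sigma>\<^sup>2)"
  have D: "D t > 0" if "t > \<sigma>" for t
    using that \<open>\<sigma> > 0\<close> by (simp add: D_def power_strict_mono)
  have "((\<lambda>t. N u t / of_real (D t)) \<longlongrightarrow> A) at_top"
  proof -
    have "((\<lambda>t::real. 1 / t) \<longlongrightarrow> 0) at_top" by real_asymp
    then have "((\<lambda>t. (A + B * of_real (1 / t) + C * (of_real (1 / t))\<^sup>2) / of_real (1 - (\<sigma> * (1 / t))\<^sup>2))
       \<longlongrightarrow> (A + B * of_real 0 + C * (of_real 0)\<^sup>2) / of_real (1 - (\<sigma> * 0)\<^sup>2)) at_top"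
      by (intro tendsto_intros) auto
    moreover have "eventually (\<lambda>t. (A + B * of_real (1 / t) + C * (of_real (1 / t))\<^sup>2) / of_real (1 - (\<sigma> * (1 / t))\<^sup>2)
        = N u t / of_real (D t)) at_top"
      using eventually_gt_at_top[of \<sigma>]
    proof eventually_elim
      case (elim t)
      have nz: "complex_of_real t \<noteq> 0" using elim \<open>\<sigma> > 0\<close> by simp
      have e1: "complex_of_real (1 - (\<sigma> * (1 / t))\<^sup>2) = of_real (D t) / (of_real t)\<^sup>2"
        using nz by (simp add: D_def field_simps)
      have e2: "A + B * of_real (1 / t) + C * (of_real (1 / t))\<^sup>2 = N u t / (of_real t)\<^sup>2"
        using nz by (simp add: N field_simps power2_eq_square)
      show ?case unfolding e1 e2 using nz by simp
    qed
    ultimately show ?thesis by (simp add: tendsto_cong)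
  qed
  moreover have "continuous_on UNIV (N u)" "continuous_on UNIV D"
    unfolding N D_def by (auto intro!: continuous_intros)
  ultimately obtain t where t: "t > \<sigma>" "indef m n a (of_real t * u) (N u t / of_real (D t)) = 0"
    using ray_root[of u "N u" D \<sigma> A m n a] u D by (auto simp: D_def)
  moreover have "cnj (of_real t * u) * (N u t / of_real (D t)) + p * (of_real t * u) + s * cnj (N u t / of_real (D t)) + c = 0"
  proof -
    define v where "v = cnj u"
    have vu: "u * v = 1" "cnj v = u" "cnj u = v"
      using u by (simp_all add: complex_norm_square[symmetric] v_def)
    have ss: "s * cnj s = of_real (\<sigma>\<^sup>2)"
      by (simp add: complex_norm_square[symmetric] \<sigma>_def)
    have "of_real t * v * N u t + s * cnj (N u t)
        = (s * cnj s) * (p * (of_real t * u) + c) - (u * v) * (of_real t)\<^sup>2 * (p * (of_real t * u) + c)"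
      unfolding N_def by (simp add: vu(2,3)) (simp add: algebra_simps power2_eq_square)
    also have "\<dots> = - (p * (of_real t * u) + c) * of_real (D t)"
      unfolding ss vu(1) D_def by (simp add: algebra_simps)
    finally have "of_real t * v * N u t + s * cnj (N u t) = - (p * (of_real t * u) + c) * of_real (D t)" .
    then show ?thesis
      using D[OF t(1)] by (simp add: vu field_simps)
  qed
  ultimately show ?thesis using that t(2) by blast
qed

text \<open>
Translating \<alpha> and \<beta> removes the terms with q and r, because cnj (\<alpha> - cnj r) (\<beta> - q) produces
exactly these terms with the opposite sign.
\<close>

lemma complex_and_real_quadratic_zero:
  obtains \<alpha> \<beta> where
    "cnj \<alpha> * \<beta> + p * \<alpha> + q * cnj \<alpha> + r * \<beta> + s * cnj \<beta> + c = 0"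
    "(cmod \<alpha>)\<^sup>2 - (cmod \<beta>)\<^sup>2 + 2 * Re (m * \<alpha> + n * \<beta>) + a = 0"
proof -
  define c' where "c' = c - p * cnj r - s * cnj q - r * q"
  define m' where "m' = m - r"
  define n' where "n' = n + cnj q"
  define a' where "a' = (cmod r)\<^sup>2 - (cmod q)\<^sup>2 - 2 * Re (m * cnj r + n * q) + a"
  obtain \<alpha> \<beta> where *: "cnj \<alpha> * \<beta> + p * \<alpha> + s * cnj \<beta> + c' = 0" "indef m' n' a' \<alpha> \<beta> = 0"
  proof (cases "s = 0")
    case True
    show ?thesis
    proof (cases "c' = 0")
      case True
      with \<open>s = 0\<close> show ?thesis using indefinite_zero_s0_c0[of p m' n' a'] that by auto
    next
      case False
      with \<open>s = 0\<close> show ?thesis using indefinite_zero_s0[of c' p m' n' a'] that by auto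
    qed
  next
    case False
    show ?thesis
    proof (cases "p = 0 \<and> c' = 0")
      case True
      with \<open>s \<noteq> 0\<close> show ?thesis using indefinite_zero_p0_c0[of s m' n' a'] that by auto
    next
      case False
      with \<open>s \<noteq> 0\<close> show ?thesis using indefinite_zero_generic[of s p c' m' n' a'] that by auto
    qed
  qed
  show ?thesis
  proof (rule that[of "\<alpha> - cnj r" "\<beta> - q"])
    have "cnj (\<alpha> - cnj r) * (\<beta> - q) + p * (\<alpha> - cnj r) + q * cnj (\<alpha> - cnj r) + r * (\<beta> - q)
       + s * cnj (\<beta> - q) + c = cnj \<alpha> * \<beta> + p * \<alpha> + s * cnj \<beta> + c'"
      by (simp add: c'_def algebra_simps)
    then show "cnj (\<alpha> - cnj r) * (\<beta> - q) + p * (\<alpha> - cnj r) + q * cnj (\<alpha> - cnj r) + r * (\<beta> - q)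
       + s * cnj (\<beta> - q) + c = 0" using *(1) by simp
    have "(cmod (\<alpha> - cnj r))\<^sup>2 - (cmod (\<beta> - q))\<^sup>2 + 2 * Re (m * (\<alpha> - cnj r) + n * (\<beta> - q)) + a
       = indef m' n' a' \<alpha> \<beta>"
      unfolding indef_def m'_def n'_def a'_def cmod_power2
      by (simp add: algebra_simps power2_eq_square)
    then show "(cmod (\<alpha> - cnj r))\<^sup>2 - (cmod (\<beta> - q))\<^sup>2 + 2 * Re (m * (\<alpha> - cnj r) + n * (\<beta> - q)) + a = 0"
      using *(2) by simp
  qed
qed

section \<open>Dropping a summand from a sum of squares\<close>

lemma no_linear_growth:
  fixes a b :: real
  assumes "a \<ge> 0" "\<And>t. 2 * t * a + t\<^sup>2 * b \<le> 0"
  shows "a = 0"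
proof (rule ccontr)
  assume "a \<noteq> 0"
  with assms have "a > 0" by simp
  define t where "t = a / (\<bar>b\<bar> + 1)"
  have "t > 0" using \<open>a > 0\<close> by (simp add: t_def add_nonneg_pos)
  have "t * (2 * a + t * b) \<le> 0"
    using assms(2)[of t] by (simp add: power2_eq_square algebra_simps)
  then have "2 * a + t * b \<le> 0"
    using \<open>t > 0\<close> by (simp add: mult_le_0_iff)
  moreover have "t * \<bar>b\<bar> \<le> a"
    using \<open>a > 0\<close> unfolding t_def by (simp add: field_simps)
  moreover have "t * b \<ge> - (t * \<bar>b\<bar>)"
    using mult_left_mono[of "- \<bar>b\<bar>" b t] \<open>t > 0\<close> by simp
  ultimately show False using \<open>a > 0\<close> by linarith
qed

text \<open>
Spectral theorem. A maximiser e of the Rayleigh quotient x \<bullet> f x on the unit sphere of S is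
an eigenvector: otherwise the quotient would grow to first order in the direction g = f e - (e \<bullet> f e) e,
which is what \<open>no_linear_growth\<close> excludes. The orthogonal complement of e in S is again invariant.
\<close>

lemma selfadjoint_orthonormal_eigenbasis:
  fixes f :: "'a::euclidean_space \<Rightarrow> 'a"
  assumes f: "linear f" "\<And>x y. f x \<bullet> y = x \<bullet> f y"
    and "subspace S" "f ` S \<subseteq> S"
  shows "\<exists>B. pairwise orthogonal B \<and> (\<forall>e\<in>B. norm e = 1) \<and> span B = S \<and> (\<forall>e\<in>B. \<exists>d. f e = d *\<^sub>R e)"
  using assms(3,4)
proof (induction "dim S" arbitrary: S rule: less_induct)
  case less
  show ?case
  proof (cases "S \<subseteq> {0}")
    case True
    then have "S = {0}" using subspace_0[OF less.prems(1)] by auto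
    then show ?thesis by (intro exI[of _ "{}"]) simp
  next
    case False
    then obtain z where z: "z \<in> S" "z \<noteq> 0" by auto
    define K where "K = S \<inter> sphere 0 1"
    have "compact K" unfolding K_def
      using closed_subspace[OF less.prems(1)] by (intro closed_Int_compact) auto
    moreover have "(1 / norm z) *\<^sub>R z \<in> K"
      using z subspace_scale[OF less.prems(1)] by (simp add: K_def)
    then have "K \<noteq> {}" by auto
    moreover have "continuous_on K (\<lambda>x. x \<bullet> f x)"
      by (intro continuous_on_inner continuous_on_id linear_continuous_on)
         (use f(1) in \<open>simp add: linear_conv_bounded_linear\<close>)
    ultimately have "\<exists>e\<in>K. \<forall>x\<in>K. x \<bullet> f x \<le> e \<bullet> f e"
      by (rule continuous_attains_sup)
    then obtain e where e: "e \<in> K" "\<And>x. x \<in> K \<Longrightarrow> x \<bullet> f x \<le> e \<bullet> f e"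
      by blast
    have eS: "e \<in> S" and ne: "norm e = 1" "e \<bullet> e = 1"
      using e(1) by (auto simp: K_def norm_eq_1)
    define l where "l = e \<bullet> f e"
    have max: "x \<bullet> f x \<le> l * (x \<bullet> x)" if "x \<in> S" for x
    proof (cases "x = 0")
      case True
      then show ?thesis by simp
    next
      case False
      have "(1 / norm x) *\<^sub>R x \<in> K"
        using False that subspace_scale[OF less.prems(1)] by (simp add: K_def)
      from e(2)[OF this] have "(1 / norm x)\<^sup>2 * (x \<bullet> f x) \<le> l"
        by (simp add: l_def linear_cmul[OF f(1)] power2_eq_square)
      then have "(norm x)\<^sup>2 * ((1 / norm x)\<^sup>2 * (x \<bullet> f x)) \<le> (norm x)\<^sup>2 * l"
        by (rule mult_left_mono) simp
      then show ?thesis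
        using False by (simp add: power2_norm_eq_inner[symmetric] power_one_over mult.commute)
    qed
    define g where "g = f e - l *\<^sub>R e"
    have gS: "g \<in> S"
      unfolding g_def using eS less.prems by (auto intro!: subspace_diff subspace_scale)
    have eg: "e \<bullet> g = 0" by (simp add: g_def inner_diff_right ne l_def)
    have feg: "e \<bullet> f g = g \<bullet> g"
    proof -
      have "e \<bullet> f g = f e \<bullet> g" using f(2) by simp
      also have "f e = g + l *\<^sub>R e" by (simp add: g_def)
      finally show ?thesis using eg by (simp add: inner_add_left)
    qed
    have "2 * t * (g \<bullet> g) + t\<^sup>2 * (g \<bullet> f g - l * (g \<bullet> g)) \<le> 0" for t
    proof -
      have "e + t *\<^sub>R g \<in> S" using eS gS less.prems(1) by (intro subspace_add subspace_scale)
      have "(e + t *\<^sub>R g) \<bullet> f (e + t *\<^sub>R g) = l + t * (e \<bullet> f g) + t * (g \<bullet> f e) + t\<^sup>2 * (g \<bullet> f g)"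
        by (simp add: linear_add[OF f(1)] linear_cmul[OF f(1)] inner_add_left inner_add_right
             l_def power2_eq_square distrib_left)
      also have "g \<bullet> f e = e \<bullet> f g" using f(2)[of g e] by (simp add: inner_commute)
      finally have "(e + t *\<^sub>R g) \<bullet> f (e + t *\<^sub>R g) = l + 2 * t * (g \<bullet> g) + t\<^sup>2 * (g \<bullet> f g)"
        by (simp add: feg)
      moreover have "(e + t *\<^sub>R g) \<bullet> (e + t *\<^sub>R g) = 1 + t\<^sup>2 * (g \<bullet> g)"
        using eg by (simp add: inner_add_left inner_add_right inner_commute[of g e] ne power2_eq_square)
      ultimately show ?thesis
        using max[OF \<open>e + t *\<^sub>R g \<in> S\<close>] by (simp add: algebra_simps)
    qed
    then have "g \<bullet> g = 0" by (intro no_linear_growth) auto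
    then have fe: "f e = l *\<^sub>R e" by (simp add: g_def)
    define S' where "S' = {x \<in> S. x \<bullet> e = 0}"
    have sub: "subspace S'"
      using less.prems(1) by (auto simp: subspace_def S'_def inner_add_left)
    have "S' \<subseteq> S" "e \<notin> S'" using ne by (auto simp: S'_def)
    then have "span S' \<subset> span S" using eS sub less.prems(1) by (auto simp: span_eq_iff[THEN iffD2])
    then have "dim S' < dim S" by (rule dim_psubset)
    moreover have "f ` S' \<subseteq> S'"
      using less.prems(2) by (auto simp: S'_def f(2) fe)
    ultimately obtain B where B: "pairwise orthogonal B" "\<forall>e\<in>B. norm e = 1" "span B = S'"
        "\<forall>e\<in>B. \<exists>d. f e = d *\<^sub>R e"
      using less.hyps[of S'] sub by blast
    have BS': "B \<subseteq> S'" using B(3) span_superset by blast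
    have "span (insert e B) = S"
    proof (rule subset_antisym)
      show "span (insert e B) \<subseteq> S"
        using BS' eS less.prems(1) by (intro span_minimal) (auto simp: S'_def)
      show "S \<subseteq> span (insert e B)"
      proof
        fix x assume x: "x \<in> S"
        have "x - (x \<bullet> e) *\<^sub>R e \<in> S'"
          unfolding S'_def using x eS less.prems(1) ne
          by (auto intro!: subspace_diff subspace_scale simp: inner_diff_left)
        then show "x \<in> span (insert e B)"
          using B(3) by (auto simp: span_insert)
      qed
    qed
    moreover have "pairwise orthogonal (insert e B)"
      using B(1) BS' by (auto simp: pairwise_insert orthogonal_def S'_def inner_commute)
    ultimately show ?thesis
      using B fe ne by (intro exI[of _ "insert e B"]) auto
  qed
qed

text \<open>
The trace of a bilinear map is the same in every orthonormal basis. This expresses both the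
invariance of a sum of squares under orthogonal mixing and the diagonalisation of a symmetric relation.
\<close>

lemma trace_orthonormal_basis:
  fixes \<beta> :: "'a::euclidean_space \<Rightarrow> 'a \<Rightarrow> 'b::real_vector"
  assumes \<beta>: "\<And>x. linear (\<beta> x)" "\<And>y. linear (\<lambda>x. \<beta> x y)"
    and B: "pairwise orthogonal B" "\<And>e. e \<in> B \<Longrightarrow> norm e = 1" "span B = UNIV" "finite B"
  shows "(\<Sum>e\<in>B. \<beta> e e) = (\<Sum>b\<in>Basis. \<beta> b b)"
proof -
  have "(\<Sum>b\<in>Basis. \<beta> b b) = (\<Sum>b\<in>Basis. \<beta> (\<Sum>e\<in>B. (e \<bullet> b) *\<^sub>R e) b)"
    using B by (intro sum.cong refl) (simp add: orthonormal_basis_expand inner_commute)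
  also have "\<dots> = (\<Sum>b\<in>Basis. \<Sum>e\<in>B. (e \<bullet> b) *\<^sub>R \<beta> e b)"
    by (simp add: linear_sum[OF \<beta>(2)] linear_cmul[OF \<beta>(2)])
  also have "\<dots> = (\<Sum>e\<in>B. \<Sum>b\<in>Basis. (e \<bullet> b) *\<^sub>R \<beta> e b)"
    by (rule sum.swap)
  also have "\<dots> = (\<Sum>e\<in>B. \<beta> e (\<Sum>b\<in>Basis. (e \<bullet> b) *\<^sub>R b))"
    by (simp add: linear_sum[OF \<beta>(1)] linear_cmul[OF \<beta>(1)])
  finally show ?thesis by (simp add: euclidean_representation)
qed

lemma dependent_family:
  fixes v :: "'j \<Rightarrow> 'b::euclidean_space"
  assumes "finite J" "card J > DIM('b)"
  obtains c where "\<exists>j\<in>J. c j \<noteq> 0" "(\<Sum>j\<in>J. c j *\<^sub>R v j) = 0"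
proof (cases "inj_on v J")
  case True
  then have "dependent (v ` J)"
    using assms by (intro dependent_biggerset) (simp add: card_image)
  then obtain u where u: "\<exists>x\<in>v ` J. u x \<noteq> 0" "(\<Sum>x\<in>v ` J. u x *\<^sub>R x) = 0"
    using assms(1) by (auto simp: dependent_finite)
  show ?thesis
    using u True by (intro that[of "u \<circ> v"]) (auto simp: sum.reindex)
next
  case False
  then obtain i j where ij: "i \<in> J" "j \<in> J" "i \<noteq> j" "v i = v j" by (auto simp: inj_on_def)
  define c :: "'j \<Rightarrow> real" where "c = (\<lambda>_. 0)(i := 1, j := -1)"
  have "(\<Sum>k\<in>J. c k *\<^sub>R v k) = (\<Sum>k\<in>{i, j}. c k *\<^sub>R v k)"
    using ij assms(1) by (intro sum.mono_neutral_right) (auto simp: c_def)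
  also have "\<dots> = 0" using ij by (simp add: c_def)
  finally show ?thesis using ij by (intro that[of c]) (auto simp: c_def intro!: bexI[of _ i])
qed

text \<open>
Subtract the relation, divided by its largest coefficient, from the sum: the summand with the
largest coefficient disappears, and the others keep a nonnegative weight. Changing the sign of
the relation ensures that the largest coefficient is positive.
\<close>

lemma drop_summand:
  fixes q :: "'k \<Rightarrow> 'b::real_vector"
  assumes "finite K" "(\<Sum>k\<in>K. D k *\<^sub>R q k) = 0" "\<exists>k\<in>K. D k \<noteq> 0"
  shows "\<exists>k\<^sub>0\<in>K. \<exists>w. (\<forall>k\<in>K. w k \<ge> 0) \<and> (\<Sum>k\<in>K - {k\<^sub>0}. w k *\<^sub>R q k) = (\<Sum>k\<in>K. q k)"
proof -
  have pos: ?thesis if D: "(\<Sum>k\<in>K. D k *\<^sub>R q k) = 0" "k1 \<in> K" "D k1 > 0" for D k1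
  proof -
    have fin: "finite (D ` K)" "D ` K \<noteq> {}" using assms(1) D by auto
    obtain k\<^sub>0 where k\<^sub>0: "k\<^sub>0 \<in> K" "D k\<^sub>0 = Max (D ` K)"
      using Max_in[OF fin] by (metis imageE)
    have le: "D k \<le> D k\<^sub>0" if "k \<in> K" for k using that fin k\<^sub>0 by simp
    then have "D k\<^sub>0 > 0" using D by fastforce
    define w where "w = (\<lambda>k. 1 - D k / D k\<^sub>0)"
    have "(\<Sum>k\<in>K. q k) = (\<Sum>k\<in>K. q k) - (1 / D k\<^sub>0) *\<^sub>R (\<Sum>k\<in>K. D k *\<^sub>R q k)"
      using D by simp
    also have "\<dots> = (\<Sum>k\<in>K. w k *\<^sub>R q k)"
      by (simp add: w_def sum_subtractf scaleR_left_diff_distrib scaleR_sum_right)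
    also have "\<dots> = (\<Sum>k\<in>K - {k\<^sub>0}. w k *\<^sub>R q k)"
      using k\<^sub>0 \<open>D k\<^sub>0 > 0\<close> assms(1) by (simp add: sum.remove w_def)
    finally show ?thesis
      using k\<^sub>0 le \<open>D k\<^sub>0 > 0\<close> by (intro bexI[of _ k\<^sub>0] exI[of _ w]) (auto simp: w_def)
  qed
  obtain k where k: "k \<in> K" "D k \<noteq> 0" using assms(3) by blast
  show ?thesis
  proof (cases "D k > 0")
    case True
    then show ?thesis using pos assms k by blast
  next
    case False
    then show ?thesis using pos[of "\<lambda>k. - D k" k] assms k by (simp add: sum_negf)
  qed
qed

text \<open>
The values B (h i) (h i) together with the mixed values for three indices i_1, i_2, i_3 are too many to
be linearly independent. A relation between them is a symmetric matrix that is diagonal apart from a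
3 \<times> 3 block f. Passing from h i_1, h i_2, h i_3 to the combinations given by an orthonormal eigenbasis
of f turns it into a relation between squares only, to which \<open>drop_summand\<close> applies. Mixed values for
further indices would weaken the condition on card I, but would need the spectral theorem in a space whose
dimension varies.
\<close>

lemma sum_of_squares_drop:
  fixes B :: "'a::real_vector \<Rightarrow> 'a \<Rightarrow> 'b::euclidean_space"
  assumes B: "\<And>x. linear (B x)" "\<And>y. linear (\<lambda>x. B x y)" "\<And>x y. B x y = B y x"
    and I: "finite I" "card I \<ge> 3" "card I + 3 > DIM('b)"
  obtains i\<^sub>0 g where "i\<^sub>0 \<in> I" "(\<Sum>i\<in>I - {i\<^sub>0}. B (g i) (g i)) = (\<Sum>i\<in>I. B (h i) (h i))"
proof -
  obtain I\<^sub>3 where I\<^sub>3: "I\<^sub>3 \<subseteq> I" "card I\<^sub>3 = 3"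
    using I obtain_subset_with_card_n by metis
  then obtain i\<^sub>1 i\<^sub>2 i\<^sub>3 where i: "I\<^sub>3 = {i\<^sub>1, i\<^sub>2, i\<^sub>3}" "i\<^sub>1 \<noteq> i\<^sub>2" "i\<^sub>1 \<noteq> i\<^sub>3" "i\<^sub>2 \<noteq> i\<^sub>3"
    by (auto simp: card_3_iff)
  define I' where "I' = I - I\<^sub>3"
  have II: "I = I\<^sub>3 \<union> I'" "I\<^sub>3 \<inter> I' = {}" "finite I'" "finite I\<^sub>3"
    using I\<^sub>3 I(1) i by (auto simp: I'_def)
  define v where "v = case_sum (\<lambda>i. B (h i) (h i))
     (\<lambda>k::nat. 2 *\<^sub>R (if k = 0 then B (h i\<^sub>1) (h i\<^sub>2) else if k = 1 then B (h i\<^sub>1) (h i\<^sub>3) else B (h i\<^sub>2) (h i\<^sub>3)))"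
  have "card (I <+> {0,1,2::nat}) = card I + 3"
    using I by (simp add: card_Plus)
  then obtain c where c0: "\<exists>j\<in>I <+> {0,1,2::nat}. c j \<noteq> 0" and c: "(\<Sum>j\<in>I <+> {0,1,2::nat}. c j *\<^sub>R v j) = 0"
    using dependent_family[of "I <+> {0,1,2::nat}" v] I by auto
  define x where "x = c (Inr 0)"
  define y where "y = c (Inr 1)"
  define z where "z = c (Inr 2)"
  define a where "a = c (Inl i\<^sub>1)"
  define b where "b = c (Inl i\<^sub>2)"
  define d where "d = c (Inl i\<^sub>3)"
  have rel: "(\<Sum>i\<in>I'. c (Inl i) *\<^sub>R B (h i) (h i)) + a *\<^sub>R B (h i\<^sub>1) (h i\<^sub>1) + b *\<^sub>R B (h i\<^sub>2) (h i\<^sub>2) + d *\<^sub>R B (h i\<^sub>3) (h i\<^sub>3)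
      + (2 * x) *\<^sub>R B (h i\<^sub>1) (h i\<^sub>2) + (2 * y) *\<^sub>R B (h i\<^sub>1) (h i\<^sub>3) + (2 * z) *\<^sub>R B (h i\<^sub>2) (h i\<^sub>3) = 0"
    using c I II i by (simp add: sum.Plus sum.union_disjoint v_def x_def y_def z_def a_def b_def d_def algebra_simps)
  define H where "H = (\<lambda>u::real^3. u$1 *\<^sub>R h i\<^sub>1 + u$2 *\<^sub>R h i\<^sub>2 + u$3 *\<^sub>R h i\<^sub>3)"
  define f where "f = (\<lambda>u::real^3. vector [a * u$1 + x * u$2 + y * u$3, x * u$1 + b * u$2 + z * u$3, y * u$1 + z * u$2 + d * u$3] :: real^3)"
  have H: "linear H" unfolding H_def by (intro linearI) (simp_all add: algebra_simps)
  have f: "linear f" unfolding f_def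
    by (intro linearI) (simp_all add: vec_eq_iff forall_3 algebra_simps)
  have sym: "f u \<bullet> w = u \<bullet> f w" for u w
    by (simp add: f_def inner_vec_def sum_3 algebra_simps)
  obtain X where X: "pairwise orthogonal X" "\<forall>e\<in>X. norm e = 1" "span X = UNIV" "\<forall>e\<in>X. \<exists>d. f e = d *\<^sub>R e"
    using selfadjoint_orthonormal_eigenbasis[OF f sym, of UNIV] by auto
  then obtain D where D: "\<And>e. e \<in> X \<Longrightarrow> f e = D e *\<^sub>R e" by metis
  have "independent X" using X by (intro pairwise_orthogonal_independent) auto
  then have "finite X" by (rule independent_imp_finite)
  have "card X = 3"
    using dim_eq_card_independent[OF \<open>independent X\<close>] dim_span[of X] X(3) by (simp add: dim_UNIV)
  obtain \<phi> where \<phi>: "bij_betw \<phi> I\<^sub>3 X"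
    using finite_same_card_bij[of I\<^sub>3 X] II \<open>finite X\<close> \<open>card X = 3\<close> I\<^sub>3 by auto
  have Basis3: "(\<Sum>b\<in>Basis. F b) = F (axis 1 1) + F (axis 2 1) + F (axis 3 1)" for F :: "real^3 \<Rightarrow> 'b"
  proof -
    have inj: "inj (\<lambda>i::3. axis i (1::real))" by (auto simp: inj_on_def axis_eq_axis)
    have "(Basis :: (real^3) set) = (\<lambda>i. axis i 1) ` UNIV" by (auto simp: Basis_vec_def)
    then have "(\<Sum>b\<in>Basis. F b) = (\<Sum>b\<in>(\<lambda>i. axis i 1) ` UNIV. F b)" by (rule arg_cong)
    also have "\<dots> = (\<Sum>i\<in>UNIV. F (axis i 1))" by (subst sum.reindex[OF inj]) simp
    finally show ?thesis by (simp only: sum_3)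
  qed
  define g where "g = (\<lambda>i. if i \<in> I\<^sub>3 then H (\<phi> i) else h i)"
  define E where "E = (\<lambda>i. if i \<in> I\<^sub>3 then D (\<phi> i) else c (Inl i))"
  have split: "(\<Sum>i\<in>I. F i) = (\<Sum>i\<in>I\<^sub>3. F i) + (\<Sum>i\<in>I'. F i)" for F :: "_ \<Rightarrow> 'b"
    using II by (metis sum.union_disjoint)
  have lin1: "linear (\<lambda>w. B (H u) (H w))" "linear (\<lambda>u. B (H u) (H w))" for u w
    using linear_compose[OF H B(1)] linear_compose[OF H B(2)] by (simp_all add: comp_def)
  have lin2: "linear (\<lambda>w. B (H (f u)) (H w))" "linear (\<lambda>u. B (H (f u)) (H w))" for u w
    using lin1 linear_compose[OF f lin1(2)] by (simp_all add: comp_def)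
  have HA: "H (axis 1 1) = h i\<^sub>1" "H (axis 2 1) = h i\<^sub>2" "H (axis 3 1) = h i\<^sub>3"
    by (simp_all add: H_def axis_def)
  have "(\<Sum>i\<in>I\<^sub>3. B (g i) (g i)) = (\<Sum>e\<in>X. B (H e) (H e))"
    using sum.reindex_bij_betw[OF \<phi>, of "\<lambda>e. B (H e) (H e)"] by (simp add: g_def)
  also have "\<dots> = (\<Sum>b\<in>Basis. B (H b) (H b))"
    using X \<open>finite X\<close> by (intro trace_orthonormal_basis lin1) auto
  also have "\<dots> = (\<Sum>i\<in>I\<^sub>3. B (h i) (h i))"
    unfolding Basis3 HA using i by (simp add: add.assoc)
  finally have total: "(\<Sum>i\<in>I. B (g i) (g i)) = (\<Sum>i\<in>I. B (h i) (h i))"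
    unfolding split by (simp add: g_def I'_def)
  have "(\<Sum>i\<in>I\<^sub>3. E i *\<^sub>R B (g i) (g i)) = (\<Sum>e\<in>X. D e *\<^sub>R B (H e) (H e))"
    using sum.reindex_bij_betw[OF \<phi>, of "\<lambda>e. D e *\<^sub>R B (H e) (H e)"] by (simp add: g_def E_def)
  also have "\<dots> = (\<Sum>e\<in>X. B (H (f e)) (H e))"
    by (intro sum.cong refl) (simp add: D linear_cmul[OF H] linear_cmul[OF B(2)])
  also have "\<dots> = (\<Sum>b\<in>Basis. B (H (f b)) (H b))"
    using X \<open>finite X\<close> by (intro trace_orthonormal_basis lin2) auto
  also have "\<dots> = a *\<^sub>R B (h i\<^sub>1) (h i\<^sub>1) + b *\<^sub>R B (h i\<^sub>2) (h i\<^sub>2) + d *\<^sub>R B (h i\<^sub>3) (h i\<^sub>3)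
      + (2 * x) *\<^sub>R B (h i\<^sub>1) (h i\<^sub>2) + (2 * y) *\<^sub>R B (h i\<^sub>1) (h i\<^sub>3) + (2 * z) *\<^sub>R B (h i\<^sub>2) (h i\<^sub>3)"
  proof -
    have "H (f (axis 1 1)) = a *\<^sub>R h i\<^sub>1 + x *\<^sub>R h i\<^sub>2 + y *\<^sub>R h i\<^sub>3"
      "H (f (axis 2 1)) = x *\<^sub>R h i\<^sub>1 + b *\<^sub>R h i\<^sub>2 + z *\<^sub>R h i\<^sub>3"
      "H (f (axis 3 1)) = y *\<^sub>R h i\<^sub>1 + z *\<^sub>R h i\<^sub>2 + d *\<^sub>R h i\<^sub>3"
      by (simp_all add: f_def H_def axis_def)
    then show ?thesis
      unfolding Basis3 HA
      by (simp only: linear_add[OF B(2)] linear_cmul[OF B(2)] mult_2 scaleR_add_left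
          B(3)[of "h i\<^sub>2" "h i\<^sub>1"] B(3)[of "h i\<^sub>3" "h i\<^sub>1"] B(3)[of "h i\<^sub>3" "h i\<^sub>2"]) simp
  qed
  finally have zero: "(\<Sum>i\<in>I. E i *\<^sub>R B (g i) (g i)) = 0"
    unfolding split using rel by (simp add: g_def E_def I'_def algebra_simps)
  \<comment> \<open>If all diagonal coefficients vanished, then so would f, and with it the whole relation.\<close>
  have "\<exists>i\<in>I. E i \<noteq> 0"
  proof (rule ccontr)
    assume "\<not> ?thesis"
    then have E0: "\<And>i. i \<in> I \<Longrightarrow> E i = 0" by blast
    have "f e = 0" if "e \<in> X" for e
    proof -
      have "e \<in> \<phi> ` I\<^sub>3" using \<phi> that by (simp add: bij_betw_def)
      then obtain i where "i \<in> I\<^sub>3" "\<phi> i = e" by blast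
      then show ?thesis using E0[of i] D[OF that] I\<^sub>3 by (auto simp: E_def)
    qed
    then have f0: "f u = 0" for u
      using linear_eq_0_on_span[OF f, of X u] X(3) by auto
    have "a = 0" "x = 0" "y = 0" "b = 0" "z = 0" "d = 0"
      using f0[of "axis 1 1"] f0[of "axis 2 1"] f0[of "axis 3 1"]
      by (simp_all add: f_def vec_eq_iff forall_3 axis_def)
    moreover have "c (Inl i) = 0" if "i \<in> I'" for i
      using E0[of i] that by (auto simp: E_def I'_def)
    ultimately show False
      using c0 II i by (auto simp: x_def y_def z_def a_def b_def d_def)
  qed
  from drop_summand[OF I(1) zero this] obtain i\<^sub>0 w where w: "i\<^sub>0 \<in> I" "\<forall>i\<in>I. w i \<ge> 0"
      "(\<Sum>i\<in>I - {i\<^sub>0}. w i *\<^sub>R B (g i) (g i)) = (\<Sum>i\<in>I. B (g i) (g i))"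
    by blast
  \<comment> \<open>The nonnegative weights are absorbed into the vectors.\<close>
  have "B (sqrt (w i) *\<^sub>R g i) (sqrt (w i) *\<^sub>R g i) = w i *\<^sub>R B (g i) (g i)" if "i \<in> I" for i
  proof -
    have "w i \<ge> 0" using w that by blast
    then show ?thesis by (simp add: linear_cmul[OF B(1)] linear_cmul[OF B(2)])
  qed
  then have "(\<Sum>i\<in>I - {i\<^sub>0}. B (sqrt (w i) *\<^sub>R g i) (sqrt (w i) *\<^sub>R g i)) = (\<Sum>i\<in>I. B (h i) (h i))"
    using w(3) total by simp
  then show ?thesis by (rule that[OF w(1)])
qed

section \<open>Isotropic vectors of self-adjoint tuples\<close>

lemma cinner_add_right: "cinner x (y + z) = cinner x y + cinner (x :: 'a::complex_inner) z"
  by (metis cinner_commute cinner_add_left complex_cnj_add)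

lemma cinner_scaleC_right: "cinner x (c *\<^sub>C y) = cnj c * cinner (x :: 'a::complex_inner) y"
  by (metis cinner_commute cinner_scaleC_left complex_cnj_mult)

lemma cinner_scaleR_left: "cinner (r *\<^sub>R x) y = of_real r * cinner (x :: 'a::complex_inner) y"
  by (simp add: scaleR_scaleC cinner_scaleC_left)

lemma cinner_scaleR_right: "cinner x (r *\<^sub>R y) = of_real r * cinner (x :: 'a::complex_inner) y"
  by (simp add: scaleR_scaleC cinner_scaleC_right)

lemma cinner_zero_right: "cinner x 0 = 0"
  using cinner_scaleR_right[of x 0 0] by simp

text \<open>
The forms are needed both for the given operators and for their shifts by real multiples of the
identity.
\<close>

locale selfadjoint_tuple =
  fixes T :: "'d::finite \<Rightarrow> 'a::complex_inner \<Rightarrow> 'a"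
  assumes add: "T i (x + y) = T i x + T i y"
    and scaleC: "T i (c *\<^sub>C x) = c *\<^sub>C T i x"
    and adj: "selfadjoint (T i)"
begin

definition re_form :: "'a \<Rightarrow> 'a \<Rightarrow> real ^ 'd" where
  "re_form x y = (\<chi> i. Re (cinner (T i x) y))"

definition im_form :: "'a \<Rightarrow> 'a \<Rightarrow> real ^ 'd" where
  "im_form x y = (\<chi> i. Im (cinner (T i x) y))"

lemma form_commute: "cinner (T i y) x = cnj (cinner (T i x) y)"
  using adj cinner_commute[of "T i y" x] unfolding selfadjoint_def by simp

lemma re_form_commute: "re_form y x = re_form x y"
  by (simp add: re_form_def form_commute[of _ y x])

lemma re_form_combination:
  "re_form (\<alpha> *\<^sub>C x + y) (\<alpha> *\<^sub>C x + y) =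
     (cmod \<alpha>)\<^sup>2 *\<^sub>R re_form x x + re_form y y + 2 *\<^sub>R (Re \<alpha> *\<^sub>R re_form x y - Im \<alpha> *\<^sub>R im_form x y)"
proof -
  have "(cmod \<alpha>)\<^sup>2 = Re \<alpha> * Re \<alpha> + Im \<alpha> * Im \<alpha>"
    unfolding cmod_power2 by (simp add: power2_eq_square)
  then show ?thesis
    by (simp add: vec_eq_iff re_form_def im_form_def add scaleC cinner_add_left cinner_add_right
        cinner_scaleC_left cinner_scaleC_right form_commute[of _ y x] algebra_simps)
qed

lemma re_form_right: "re_form x (\<beta> *\<^sub>C y + z) = Re \<beta> *\<^sub>R re_form x y + Im \<beta> *\<^sub>R im_form x y + re_form x z"
  by (simp add: vec_eq_iff re_form_def im_form_def cinner_add_right cinner_scaleC_right)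

lemma im_form_right: "im_form x (\<beta> *\<^sub>C y + z) = Re \<beta> *\<^sub>R im_form x y - Im \<beta> *\<^sub>R re_form x y + im_form x z"
  by (simp add: vec_eq_iff re_form_def im_form_def cinner_add_right cinner_scaleC_right)

lemma forms_zero_right: "re_form x 0 = 0" "im_form x 0 = 0"
  by (simp_all add: vec_eq_iff re_form_def im_form_def cinner_zero_right)

lemma re_form_scaleC: "re_form (c *\<^sub>C x) (c *\<^sub>C x) = (cmod c)\<^sup>2 *\<^sub>R re_form x x"
  using re_form_combination[of c x 0] by (simp add: forms_zero_right)

lemma re_form_scaleR: "re_form (r *\<^sub>R x) (r *\<^sub>R x) = r\<^sup>2 *\<^sub>R re_form x x"
  by (simp add: scaleR_scaleC re_form_scaleC)

lemma linear_re_form_right: "linear (re_form x)"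
  by (rule linearI) (simp_all add: vec_eq_iff re_form_def cinner_add_right cinner_scaleR_right)

text \<open>
The dependence is a traceless Hermitian matrix M with first row (a, cnj b) and second row (b, -a). Its
eigenvalues are \<plusminus>\<lambda> with \<lambda> = sqrt (a^2 + |b|^2), so M + \<lambda> I has rank one: it is a multiple of the
projection onto an eigenvector. Pairing with the form kills both M, by the dependence, and I, by the
hypothesis that the sum is zero; hence the combination of h_1 and h_2 given by this eigenvector is isotropic.
\<close>

lemma isotropic_of_dependent:
  assumes sum0: "re_form h\<^sub>1 h\<^sub>1 + re_form h\<^sub>2 h\<^sub>2 = 0" and nz: "h\<^sub>1 \<noteq> 0 \<or> h\<^sub>2 \<noteq> 0"
    and dep: "x *\<^sub>R re_form h\<^sub>1 h\<^sub>1 + y *\<^sub>R re_form h\<^sub>1 h\<^sub>2 + z *\<^sub>R im_form h\<^sub>1 h\<^sub>2 = 0"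
    and xyz: "x \<noteq> 0 \<or> y \<noteq> 0 \<or> z \<noteq> 0"
  obtains g where "g \<noteq> 0" "re_form g g = 0"
proof -
  obtain a b where a: "a \<ge> 0" "a \<noteq> 0 \<or> b \<noteq> 0"
    and ab: "a *\<^sub>R re_form h\<^sub>1 h\<^sub>1 + Re b *\<^sub>R re_form h\<^sub>1 h\<^sub>2 + Im b *\<^sub>R im_form h\<^sub>1 h\<^sub>2 = 0"
  proof (cases "x \<ge> 0")
    case True
    show ?thesis using that[of x "Complex y z"] True dep xyz by (auto simp: complex_eq_iff)
  next
    case False
    have "(-x) *\<^sub>R re_form h\<^sub>1 h\<^sub>1 + (-y) *\<^sub>R re_form h\<^sub>1 h\<^sub>2 + (-z) *\<^sub>R im_form h\<^sub>1 h\<^sub>2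
        = - (x *\<^sub>R re_form h\<^sub>1 h\<^sub>1 + y *\<^sub>R re_form h\<^sub>1 h\<^sub>2 + z *\<^sub>R im_form h\<^sub>1 h\<^sub>2)" by simp
    also have "\<dots> = 0" using dep by simp
    finally show ?thesis using that[of "-x" "Complex (-y) (-z)"] False by auto
  qed
  \<comment> \<open>The eigenvector has coordinates (\<lambda> + a, b). Choosing a \<ge> 0, by changing the sign of the
    dependence, keeps its first coordinate positive.\<close>
  define s where "s = sqrt (a\<^sup>2 + (cmod b)\<^sup>2) + a"
  have "a\<^sup>2 + (cmod b)\<^sup>2 > 0" using a(2) by (auto intro: add_pos_nonneg add_nonneg_pos)
  then have s: "s > 0" using a(1) by (simp add: s_def add_pos_nonneg)
  have "(s - a)\<^sup>2 = a\<^sup>2 + (cmod b)\<^sup>2" by (simp add: s_def)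
  then have s2: "s\<^sup>2 - (cmod b)\<^sup>2 = 2 * s * a" by (simp add: power2_diff)
  define g where "g = of_real s *\<^sub>C h\<^sub>1 + b *\<^sub>C h\<^sub>2"
  have h2: "re_form h\<^sub>2 h\<^sub>2 = - re_form h\<^sub>1 h\<^sub>1" using sum0 by (simp add: eq_neg_iff_add_eq_0 add.commute)
  have "re_form g g = s\<^sup>2 *\<^sub>R re_form h\<^sub>1 h\<^sub>1 + (cmod b)\<^sup>2 *\<^sub>R re_form h\<^sub>2 h\<^sub>2
      + (2 * s) *\<^sub>R (Re b *\<^sub>R re_form h\<^sub>1 h\<^sub>2 + Im b *\<^sub>R im_form h\<^sub>1 h\<^sub>2)"
    unfolding g_def re_form_combination using re_form_right[of h\<^sub>1 b h\<^sub>2 0] s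
    by (simp add: re_form_scaleC forms_zero_right)
  also have "\<dots> = (s\<^sup>2 - (cmod b)\<^sup>2) *\<^sub>R re_form h\<^sub>1 h\<^sub>1
      + (2 * s) *\<^sub>R (Re b *\<^sub>R re_form h\<^sub>1 h\<^sub>2 + Im b *\<^sub>R im_form h\<^sub>1 h\<^sub>2)"
    by (simp add: h2 scaleR_left_diff_distrib)
  also have "\<dots> = (2 * s) *\<^sub>R (a *\<^sub>R re_form h\<^sub>1 h\<^sub>1 + Re b *\<^sub>R re_form h\<^sub>1 h\<^sub>2 + Im b *\<^sub>R im_form h\<^sub>1 h\<^sub>2)"
    unfolding s2 by (simp add: scaleR_add_right)
  also have "\<dots> = 0" by (simp add: ab)
  finally have g0: "re_form g g = 0" .
  show ?thesis
  proof (cases "g = 0")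
    case False
    then show ?thesis using that g0 by blast
  next
    case True
    \<comment> \<open>Here h_1 and h_2 are proportional, so their forms are proportional with a nonnegative factor; as they
      have opposite signs, both vanish.\<close>
    then have "of_real s *\<^sub>C h\<^sub>1 = - (b *\<^sub>C h\<^sub>2)" by (simp add: g_def eq_neg_iff_add_eq_0)
    also have "\<dots> = (-b) *\<^sub>C h\<^sub>2" by (simp add: complex_vector.scale_minus_left)
    finally have "s\<^sup>2 *\<^sub>R re_form h\<^sub>1 h\<^sub>1 = (cmod b)\<^sup>2 *\<^sub>R re_form h\<^sub>2 h\<^sub>2"
      using re_form_scaleC[of "of_real s" h\<^sub>1] re_form_scaleC[of "-b" h\<^sub>2] s by simp
    then have "(s\<^sup>2 + (cmod b)\<^sup>2) *\<^sub>R re_form h\<^sub>1 h\<^sub>1 = 0"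
      by (simp add: h2 scaleR_add_left)
    moreover have "s\<^sup>2 + (cmod b)\<^sup>2 \<noteq> 0" using s by (simp add: sum_power2_eq_zero_iff)
    ultimately have "re_form h\<^sub>1 h\<^sub>1 = 0" by (metis scaleR_eq_0_iff)
    then show ?thesis using that[of h\<^sub>1] that[of h\<^sub>2] nz h2 by auto
  qed
qed

text \<open>
The three vectors form a basis of \<real>^3. In the coordinates L given by it, the form at \<alpha> h_1 + \<beta> h_2 is
(2 cnj \<alpha> \<beta>, |\<alpha>|^2 - |\<beta>|^2), and adding h_3 contributes only real-affine terms in \<alpha> and \<beta>.
\<close>

lemma isotropic_of_independent:
  assumes sum0: "re_form h\<^sub>1 h\<^sub>1 + re_form h\<^sub>2 h\<^sub>2 = 0"
    and indep: "\<And>x y z. x *\<^sub>R re_form h\<^sub>1 h\<^sub>1 + y *\<^sub>R re_form h\<^sub>1 h\<^sub>2 + z *\<^sub>R im_form h\<^sub>1 h\<^sub>2 = 0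
      \<Longrightarrow> x = 0 \<and> y = 0 \<and> z = 0"
    and card: "CARD('d) = 3"
    and h\<^sub>3: "\<And>\<alpha> \<beta>. h\<^sub>3 \<noteq> \<alpha> *\<^sub>C h\<^sub>1 + \<beta> *\<^sub>C h\<^sub>2"
  obtains g where "g \<noteq> 0" "re_form g g = 0"
proof -
  define L :: "complex \<times> real \<Rightarrow> real ^ 'd" where
    "L = (\<lambda>(w, x). x *\<^sub>R re_form h\<^sub>1 h\<^sub>1 + Re w *\<^sub>R re_form h\<^sub>1 h\<^sub>2 + Im w *\<^sub>R im_form h\<^sub>1 h\<^sub>2)"
  have lin: "linear L"
    by (rule linearI) (auto simp: L_def scaleR_add_left scaleR_add_right)
  have inj: "inj L"
    using indep unfolding linear_injective_0[OF lin] by (auto simp: L_def complex_eq_iff zero_prod_def)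
  have "dim (range L) = DIM(complex \<times> real)"
    using dim_image_eq[OF lin, of UNIV] inj by simp
  also have "\<dots> = DIM(real ^ 'd)" using card by simp
  finally have "dim (range L) = dim (UNIV :: (real ^ 'd) set)" by simp
  then have surj: "range L = UNIV"
    using subspace_dim_equal[of "range L" UNIV] linear_subspace_image[OF lin] by simp
  then have ex: "\<exists>k e. v = L (k, e)" for v
    by (metis surjD surj_pair)
  obtain k\<^sub>1 e\<^sub>1 where F1: "re_form h\<^sub>1 h\<^sub>3 = L (k\<^sub>1, e\<^sub>1)" using ex by blast
  obtain k\<^sub>1' e\<^sub>1' where G1: "im_form h\<^sub>1 h\<^sub>3 = L (k\<^sub>1', e\<^sub>1')" using ex by blast
  obtain k\<^sub>2 e\<^sub>2 where F2: "re_form h\<^sub>2 h\<^sub>3 = L (k\<^sub>2, e\<^sub>2)" using ex by blast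
  obtain k\<^sub>2' e\<^sub>2' where G2: "im_form h\<^sub>2 h\<^sub>3 = L (k\<^sub>2', e\<^sub>2')" using ex by blast
  obtain c a where F3: "re_form h\<^sub>3 h\<^sub>3 = L (c, a)" using ex by blast
  obtain \<alpha> \<beta> where
    eq: "cnj \<alpha> * \<beta> + (k\<^sub>1 + \<i> * k\<^sub>1') / 2 * \<alpha> + (k\<^sub>1 - \<i> * k\<^sub>1') / 2 * cnj \<alpha>
       + (k\<^sub>2 + \<i> * k\<^sub>2') / 2 * \<beta> + (k\<^sub>2 - \<i> * k\<^sub>2') / 2 * cnj \<beta> + c / 2 = 0"
    "(cmod \<alpha>)\<^sup>2 - (cmod \<beta>)\<^sup>2 + 2 * Re (Complex e\<^sub>1 e\<^sub>1' * \<alpha> + Complex e\<^sub>2 e\<^sub>2' * \<beta>) + a = 0"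
    by (rule complex_and_real_quadratic_zero)
  \<comment> \<open>The pair (w, x) consists of the L-coordinates of the form at \<alpha> h_1 + \<beta> h_2 + h_3.\<close>
  define w where "w = 2 * (cnj \<alpha> * \<beta>) + 2 * (of_real (Re \<alpha>) * k\<^sub>1 - of_real (Im \<alpha>) * k\<^sub>1')
     + 2 * (of_real (Re \<beta>) * k\<^sub>2 - of_real (Im \<beta>) * k\<^sub>2') + c"
  define x where "x = (cmod \<alpha>)\<^sup>2 - (cmod \<beta>)\<^sup>2 + 2 * (Re \<alpha> * e\<^sub>1 - Im \<alpha> * e\<^sub>1') + 2 * (Re \<beta> * e\<^sub>2 - Im \<beta> * e\<^sub>2') + a"
  have "w = 2 * (cnj \<alpha> * \<beta> + (k\<^sub>1 + \<i> * k\<^sub>1') / 2 * \<alpha> + (k\<^sub>1 - \<i> * k\<^sub>1') / 2 * cnj \<alpha>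
       + (k\<^sub>2 + \<i> * k\<^sub>2') / 2 * \<beta> + (k\<^sub>2 - \<i> * k\<^sub>2') / 2 * cnj \<beta> + c / 2)"
    unfolding w_def by (simp add: complex_eq_iff) (simp add: field_simps)
  then have w: "w = 0" unfolding eq(1) by simp
  have x: "x = 0" using eq(2) by (simp add: x_def algebra_simps)
  define g where "g = \<alpha> *\<^sub>C h\<^sub>1 + (\<beta> *\<^sub>C h\<^sub>2 + h\<^sub>3)"
  have h2: "re_form h\<^sub>2 h\<^sub>2 = - re_form h\<^sub>1 h\<^sub>1" using sum0 by (simp add: eq_neg_iff_add_eq_0 add.commute)
  have "re_form g g = L (w, x)"
    unfolding g_def re_form_combination[of \<alpha> h\<^sub>1] re_form_combination[of \<beta> h\<^sub>2 h\<^sub>3]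
      re_form_right[of h\<^sub>1 \<beta> h\<^sub>2 h\<^sub>3] im_form_right[of h\<^sub>1 \<beta> h\<^sub>2 h\<^sub>3] F1 G1 F2 G2 F3 h2
      w_def x_def L_def
    by (simp add: algebra_simps)
  then have "re_form g g = 0" using w x by (simp add: L_def)
  moreover have "g \<noteq> 0"
  proof
    assume "g = 0"
    then have "h\<^sub>3 = - (\<alpha> *\<^sub>C h\<^sub>1 + \<beta> *\<^sub>C h\<^sub>2)" by (simp add: g_def eq_neg_iff_add_eq_0 algebra_simps)
    then have "h\<^sub>3 = (-\<alpha>) *\<^sub>C h\<^sub>1 + (-\<beta>) *\<^sub>C h\<^sub>2" by (simp add: complex_vector.scale_minus_left)
    then show False using h\<^sub>3 by blast
  qed
  ultimately show ?thesis using that by blast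
qed

lemma isotropic_of_pair:
  assumes sum0: "re_form h\<^sub>1 h\<^sub>1 + re_form h\<^sub>2 h\<^sub>2 = 0" and nz: "h\<^sub>1 \<noteq> 0 \<or> h\<^sub>2 \<noteq> 0"
    and dims: "CARD('d) = 2 \<or> CARD('d) = 3 \<and> cdim (UNIV :: 'a set) \<ge> 3"
  obtains g where "g \<noteq> 0" "re_form g g = 0"
proof (cases "\<exists>x y z. x *\<^sub>R re_form h\<^sub>1 h\<^sub>1 + y *\<^sub>R re_form h\<^sub>1 h\<^sub>2 + z *\<^sub>R im_form h\<^sub>1 h\<^sub>2 = 0
    \<and> (x \<noteq> 0 \<or> y \<noteq> 0 \<or> z \<noteq> 0)")
  case True
  then show ?thesis using isotropic_of_dependent[OF sum0 nz] that by metis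
next
  case False
  \<comment> \<open>Three vectors in a plane are dependent.\<close>
  have "CARD('d) \<noteq> 2"
  proof
    assume "CARD('d) = 2"
    define v where "v = (\<lambda>k::nat. if k = 0 then re_form h\<^sub>1 h\<^sub>1 else if k = 1 then re_form h\<^sub>1 h\<^sub>2 else im_form h\<^sub>1 h\<^sub>2)"
    obtain c where "\<exists>j\<in>{0, 1, 2::nat}. c j \<noteq> 0" "(\<Sum>j\<in>{0, 1, 2::nat}. c j *\<^sub>R v j) = 0"
      using dependent_family[of "{0, 1, 2::nat}" v] \<open>CARD('d) = 2\<close> by auto
    then have "(c 0 \<noteq> 0 \<or> c 1 \<noteq> 0 \<or> c 2 \<noteq> 0) \<and>
      c 0 *\<^sub>R re_form h\<^sub>1 h\<^sub>1 + c 1 *\<^sub>R re_form h\<^sub>1 h\<^sub>2 + c 2 *\<^sub>R im_form h\<^sub>1 h\<^sub>2 = 0"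
      by (simp add: v_def add.assoc)
    then show False using False by blast
  qed
  with dims have card: "CARD('d) = 3" and dim: "cdim (UNIV :: 'a set) \<ge> 3" by auto
  obtain h\<^sub>3 where "h\<^sub>3 \<notin> complex_vector.span {h\<^sub>1, h\<^sub>2}"
  proof (rule ccontr)
    assume "\<not> thesis"
    with that have sub: "UNIV \<subseteq> complex_vector.span {h\<^sub>1, h\<^sub>2}" by blast
    then have "complex_vector.dim (UNIV :: 'a set) \<le> card {h\<^sub>1, h\<^sub>2}"
      by (rule complex_vector.dim_le_card) simp
    also have "\<dots> \<le> 2" by (cases "h\<^sub>1 = h\<^sub>2") auto
    finally have "cdim (UNIV :: 'a set) \<le> 2"
      unfolding cdim_def using sub by (auto simp: numeral_eq_enat intro!: exI[of _ "{h\<^sub>1, h\<^sub>2}"])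
    from order_trans[OF dim this] show False by simp
  qed
  then have "h\<^sub>3 \<noteq> \<alpha> *\<^sub>C h\<^sub>1 + \<beta> *\<^sub>C h\<^sub>2" for \<alpha> \<beta>
    by (metis complex_vector.span_add complex_vector.span_scale complex_vector.span_base insertCI)
  then show ?thesis
    using isotropic_of_independent[OF sum0 _ card, of h\<^sub>3] False that by metis
qed

subsection \<open>Points of the convex hull as sums of energies\<close>

definition energy :: "'a \<Rightarrow> (real ^ 'd) \<times> real" where
  "energy h = (re_form h h, (norm h)\<^sup>2)"

lemma energy_scaleR: "energy (r *\<^sub>R h) = r\<^sup>2 *\<^sub>R energy h"
  by (simp add: energy_def re_form_scaleR power_mult_distrib)

lemma joint_numerical_range_energy: "v \<in> joint_numerical_range T \<longleftrightarrow> (v, 1) \<in> range energy"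
proof -
  have "1 = (norm h)\<^sup>2 \<longleftrightarrow> norm h = 1" for h :: 'a
    by (metis abs_norm_cancel abs_square_eq_1)
  then show ?thesis
    by (auto simp: joint_numerical_range_def energy_def re_form_def image_iff)
qed

lemma convex_hull_energy:
  assumes "p \<in> convex hull joint_numerical_range T"
  obtains J :: "(real ^ 'd) set" and g where "finite J" "(\<Sum>j\<in>J. energy (g j)) = (p, 1)"
proof -
  obtain J u where J: "finite J" "J \<subseteq> joint_numerical_range T" "\<forall>v\<in>J. 0 \<le> u v" "sum u J = 1"
      "(\<Sum>v\<in>J. u v *\<^sub>R v) = p"
    using assms unfolding convex_hull_explicit by blast
  have "\<forall>v\<in>J. \<exists>h. energy h = (v, 1)"
    using J(2) joint_numerical_range_energy by (metis imageE subsetD)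
  then obtain h where h: "\<And>v. v \<in> J \<Longrightarrow> energy (h v) = (v, 1)" by metis
  have "(\<Sum>v\<in>J. energy (sqrt (u v) *\<^sub>R h v)) = (\<Sum>v\<in>J. (u v *\<^sub>R v, u v))"
    using J(3) by (intro sum.cong refl) (simp add: energy_scaleR h)
  also have "\<dots> = (p, 1)" using J by (simp add: sum_prod)
  finally show ?thesis by (rule that[OF J(1)])
qed

text \<open>
Vectors that are zero contribute nothing; the others are normalised, and their squared norms are the
weights. Different vectors may give the same point of the joint numerical range, so the weights on the
set of points are taken from the description of its convex hull.
\<close>

lemma energy_convex_combination:
  assumes J: "finite J" "card J \<le> n" and sum: "(\<Sum>j\<in>J. energy (g j)) = (p, 1)"
  shows "convex_combination_of_at_most n (joint_numerical_range T) p"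
proof -
  define J' where "J' = {j \<in> J. g j \<noteq> 0}"
  define v where "v = (\<lambda>j. re_form (g j) (g j) /\<^sub>R (norm (g j))\<^sup>2)"
  have fin: "finite J'" using J by (simp add: J'_def)
  have v: "v j \<in> joint_numerical_range T" if "j \<in> J'" for j
  proof -
    have "energy ((1 / norm (g j)) *\<^sub>R g j) = (v j, 1)"
      using that unfolding energy_scaleR by (simp add: energy_def v_def J'_def divide_inverse power_inverse)
    then show ?thesis unfolding joint_numerical_range_energy by (metis rangeI)
  qed
  have "(\<Sum>j\<in>J. energy (g j)) = (\<Sum>j\<in>J'. energy (g j))"
    using J by (intro sum.mono_neutral_right) (auto simp: J'_def energy_def forms_zero_right zero_prod_def)
  also have "\<dots> = (\<Sum>j\<in>J'. ((norm (g j))\<^sup>2 *\<^sub>R v j, (norm (g j))\<^sup>2))"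
    by (intro sum.cong refl) (simp add: energy_def v_def J'_def)
  finally have p: "p = (\<Sum>j\<in>J'. (norm (g j))\<^sup>2 *\<^sub>R v j)" "(\<Sum>j\<in>J'. (norm (g j))\<^sup>2) = 1"
    using sum by (simp_all add: sum_prod)
  have "p \<in> convex hull (v ` J')"
    unfolding p(1) using fin p(2) by (intro convex_sum) (auto intro: hull_inc)
  then obtain u where u: "\<forall>x\<in>v ` J'. 0 \<le> u x" "sum u (v ` J') = 1" "(\<Sum>x\<in>v ` J'. u x *\<^sub>R x) = p"
    using fin by (auto simp: convex_hull_finite)
  have "card (v ` J') \<le> card J'" using fin by (rule card_image_le)
  also have "\<dots> \<le> n" using J card_mono[of J J'] by (auto simp: J'_def)
  finally show ?thesis
    unfolding convex_combination_of_at_most_def using u fin v by (intro exI[of _ "v ` J'"] exI[of _ u]) auto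
qed

text \<open>
The target space of the energy has dimension d + 1, so a summand can be dropped as long as
there are at least three and more than d - 2 of them.
\<close>

lemma energy_reduce:
  fixes J :: "'j set"
  assumes "finite J"
  shows "\<exists>(J' :: 'j set) g'. finite J' \<and> card J' \<le> max 2 (CARD('d) - 2) \<and> (\<Sum>j\<in>J'. energy (g' j)) = (\<Sum>j\<in>J. energy (g j))"
  using assms
proof (induction "card J" arbitrary: J g rule: less_induct)
  case less
  show ?case
  proof (cases "card J \<le> max 2 (CARD('d) - 2)")
    case True
    then show ?thesis using less.prems by (intro exI[of _ J] exI[of _ g]) simp
  next
    case False
    define B where "B = (\<lambda>x y. (re_form x y, Re (cinner x y)))"
    have B: "linear (B x)" for x
      using linear_re_form_right[of x] unfolding B_def
      by (auto simp: linear_iff cinner_add_right cinner_scaleR_right)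
    have sym: "B x y = B y x" for x y
      using re_form_commute[of y x] cinner_commute[of y x] by (simp add: B_def)
    have B': "linear (\<lambda>x. B x y)" for y
      using B[of y] by (simp add: sym[of _ y])
    have energy: "energy h = B h h" for h
      by (simp add: energy_def B_def cinner_self)
    have "card J \<ge> 3" "card J + 3 > DIM((real ^ 'd) \<times> real)" using False by auto
    then obtain j\<^sub>0 g' where j: "j\<^sub>0 \<in> J" "(\<Sum>j\<in>J - {j\<^sub>0}. B (g' j) (g' j)) = (\<Sum>j\<in>J. B (g j) (g j))"
      by (rule sum_of_squares_drop[OF B B' sym less.prems])
    have "card (J - {j\<^sub>0}) < card J" using j(1) less.prems by (rule card_Diff1_less[rotated])
    from less.hyps[OF this, of g'] less.prems show ?thesis unfolding energy j(2) by auto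
  qed
qed

end

theorem theorem2p2:
  fixes T :: "'d::finite \<Rightarrow> 'a::complex_hilbert_space \<Rightarrow> 'a"
  assumes "CARD('d) \<ge> 2"
    and "\<And>i. bounded_clinear (T i)"
    and "\<And>i. selfadjoint (T i)"
  shows "caratheodory_number (joint_numerical_range T) \<le> CARD('d) - 1 \<and>
         (CARD('d) \<ge> 3 \<and> cdim (UNIV :: 'a set) \<ge> 3 \<longrightarrow>
            caratheodory_number (joint_numerical_range T) \<le> CARD('d) - 2)"
proof -
  interpret selfadjoint_tuple T
    using assms(2,3) by unfold_locales (auto simp: bounded_clinear_def linear_add[OF bounded_linear.linear])
  have bound: "caratheodory_number (joint_numerical_range T) \<le> n"
    if "n > 0" "\<And>p. p \<in> convex hull joint_numerical_range T \<Longrightarrow> convex_combination_of_at_most n (joint_numerical_range T) p" for n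
    unfolding caratheodory_number_def by (rule Least_le) (use that in blast)
  have few: "\<exists>J :: (real ^ 'd) set. \<exists>g. finite J \<and> card J \<le> max 2 (CARD('d) - 2) \<and> (\<Sum>j\<in>J. energy (g j)) = (p, 1)"
    if "p \<in> convex hull joint_numerical_range T" for p
    using convex_hull_energy[OF that] energy_reduce by metis
  have general: "caratheodory_number (joint_numerical_range T) \<le> max 2 (CARD('d) - 2)"
    using few energy_convex_combination by (intro bound) (simp, blast)
  have special: "caratheodory_number (joint_numerical_range T) \<le> 1"
    if dims: "CARD('d) = 2 \<or> CARD('d) = 3 \<and> cdim (UNIV :: 'a set) \<ge> 3"
  proof (rule bound)
    fix p assume "p \<in> convex hull joint_numerical_range T"
    then obtain J :: "(real ^ 'd) set" and g where J: "finite J" "card J \<le> 2" "(\<Sum>j\<in>J. energy (g j)) = (p, 1)"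
      using few[of p] dims by auto
    have "\<exists>h\<^sub>1 h\<^sub>2. energy h\<^sub>1 + energy h\<^sub>2 = (p, 1)"
    proof -
      consider "card J = 0" | "card J = 1" | "card J = 2" using J(2) by linarith
      then show ?thesis
      proof cases
        case 1
        then show ?thesis using J by (auto simp: zero_prod_def)
      next
        case 2
        then obtain j where "J = {j}" by (auto simp: card_1_singleton_iff)
        then have "energy (g j) + energy 0 = (p, 1)" using J(3) by (simp add: energy_def forms_zero_right)
        then show ?thesis by blast
      next
        case 3
        then obtain j k where "J = {j, k}" "j \<noteq> k" by (auto simp: card_2_iff)
        then have "energy (g j) + energy (g k) = (p, 1)" using J(3) by simp
        then show ?thesis by blast
      qed
    qed
    then obtain h\<^sub>1 h\<^sub>2 where h: "re_form h\<^sub>1 h\<^sub>1 + re_form h\<^sub>2 h\<^sub>2 = p" "(norm h\<^sub>1)\<^sup>2 + (norm h\<^sub>2)\<^sup>2 = 1"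
      by (auto simp: energy_def)
    \<comment> \<open>The shift by p turns a vector of energy proportional to (p, 1) into an isotropic vector.\<close>
    define T' where "T' = (\<lambda>i x. T i x - p $ i *\<^sub>R x)"
    interpret T': selfadjoint_tuple T'
    proof
      fix i x y c
      show "T' i (x + y) = T' i x + T' i y"
        by (simp add: T'_def add scaleR_add_right)
      show "T' i (c *\<^sub>C x) = c *\<^sub>C T' i x"
        by (simp add: T'_def scaleC scaleR_scaleC scaleC_scaleC mult.commute complex_vector.scale_right_diff_distrib)
      have "cinner (x - r *\<^sub>R z) y = cinner x y - r * cinner z y" for x y z :: 'a and r :: real
        using cinner_add_left[of "x - r *\<^sub>R z" "r *\<^sub>R z" y] by (simp add: cinner_scaleR_left)
      moreover have "cinner y (x - r *\<^sub>R z) = cinner y x - r * cinner y z" for x y z :: 'a and r :: real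
        using cinner_add_right[of y "x - r *\<^sub>R z" "r *\<^sub>R z"] by (simp add: cinner_scaleR_right)
      ultimately show "selfadjoint (T' i)"
        using adj[of i] by (simp add: selfadjoint_def T'_def)
    qed
    have re': "T'.re_form x x = re_form x x - (norm x)\<^sup>2 *\<^sub>R p" for x
    proof -
      have "cinner (T i x - r *\<^sub>R x) x = cinner (T i x) x - r * cinner x x" for i and r :: real
        using cinner_add_left[of "T i x - r *\<^sub>R x" "r *\<^sub>R x" x] by (simp add: cinner_scaleR_left)
      then show ?thesis
        unfolding T'.re_form_def re_form_def by (simp add: vec_eq_iff T'_def cinner_self)
    qed
    have "T'.re_form h\<^sub>1 h\<^sub>1 + T'.re_form h\<^sub>2 h\<^sub>2 = p - ((norm h\<^sub>1)\<^sup>2 + (norm h\<^sub>2)\<^sup>2) *\<^sub>R p"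
      unfolding re' h(1)[symmetric] by (simp add: scaleR_add_left)
    then have "T'.re_form h\<^sub>1 h\<^sub>1 + T'.re_form h\<^sub>2 h\<^sub>2 = 0" by (simp add: h(2))
    moreover have "h\<^sub>1 \<noteq> 0 \<or> h\<^sub>2 \<noteq> 0" using h(2) by auto
    ultimately obtain g where g: "g \<noteq> 0" "T'.re_form g g = 0"
      using T'.isotropic_of_pair dims by blast
    have "energy ((1 / norm g) *\<^sub>R g) = (p, 1)"
      using g unfolding energy_scaleR by (simp add: energy_def re' power_one_over)
    then have "(\<Sum>j\<in>{p}. energy ((\<lambda>_. (1 / norm g) *\<^sub>R g) j)) = (p, 1)" by simp
    from energy_convex_combination[OF _ _ this] show "convex_combination_of_at_most 1 (joint_numerical_range T) p"
      by simp
  qed simp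
  show ?thesis
  proof (intro conjI impI)
    show "caratheodory_number (joint_numerical_range T) \<le> CARD('d) - 1"
      using general special assms(1) by (cases "CARD('d) = 2") auto
    show "caratheodory_number (joint_numerical_range T) \<le> CARD('d) - 2"
      if "CARD('d) \<ge> 3 \<and> cdim (UNIV :: 'a set) \<ge> 3"
      using general special that by (cases "CARD('d) = 3") auto
  qed
qed

end
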